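(* For each integer $n \ge 0$, let $a_1(n)$ denote the number of odd coefficients of the polynomial $(1+x+x^2)^n \in \mathbb{Z}[x]$ (equivalently, the value at $x=1$ of $(1+x+x^2)^n$ after reducing each coefficient modulo $2$ to $0$ or $1$). For $k \ge 0$ let $b_1(k) := a_1(2^k-1)$, and let $f_1(t) := \sum_{k=0}^{\infty} b_1(k)\, t^k$. Then $$ f_1(t) = \frac{1+2t}{(1+t)(1-2t)}. $$
   Context: Coefficients are reduced modulo $2$ only (not the exponents of $x$); $a_1(n)$ counts the monomials surviving this reduction. *)

theory Defs
  imports "HOL-Computational_Algebra.Computational_Algebra"
begin

definition a1 :: "nat \<Rightarrow> nat" where
  "a1 n = card {i. odd (coeff ([:1, 1, 1:] ^ n :: int poly) i)}"

definition b1 :: "nat \<Rightarrow> nat" where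
  "b1 k = a1 (2 ^ k - 1)"

text \<open>
  The generating function is a formal power series. Its coefficients are taken in the rationals
  because division of formal power series needs division in the coefficient ring.
\<close>

definition f1 :: "rat fps" where
  "f1 = Abs_fps (\<lambda>k. of_nat (b1 k))"

end

(*
  Modulo 2 we have p(x)^2 = p(x^2). Put P = 1 + x + x^2 and let w count odd coefficients.
  Splitting P p^2 into its even and odd powers of x gives w(P p^2) = w((1 + x) p) + w(p), and
  since (1 + x) P = 1 + x^3 modulo 2, the same splitting gives w((1 + x) P p^2) = 2 w(p).
  As 2^(k+1) - 1 = 2 (2^k - 1) + 1, this yields b1(k+2) = b1(k+1) + 2 b1(k).
*)
theory Submission
  imports Defs
begin

text \<open>Counting for arbitrary polynomials is needed because the recurrence passes through
  \<open>[:1, 1:] * p\<close>, where \<open>p\<close> is a power of the trinomial.\<close>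

definition odd_coeffs :: "int poly \<Rightarrow> nat" where
  "odd_coeffs p = card {i. odd (coeff p i)}"

lemma finite_odd_coeffs: "finite {i. odd (coeff (p :: int poly) i)}"
  by (rule finite_subset[of _ "{..degree p}"]) (auto intro: le_degree)

lemma odd_coeffs_pCons_0: "odd_coeffs (pCons 0 p) = odd_coeffs p"
proof -
  have "{i. odd (coeff (pCons 0 p) i)} = Suc ` {i. odd (coeff p i)}"
    by (auto simp: coeff_pCons image_iff gr0_conv_Suc split: nat.splits)
  then show ?thesis
    by (simp add: odd_coeffs_def card_image)
qed

text \<open>The hypotheses say p = q(x^2) + x r(x^2) modulo 2, and the two summands share no
  exponent.\<close>

lemma odd_coeffs_split:
  assumes even_part: "\<And>i. odd (coeff p (2 * i)) \<longleftrightarrow> odd (coeff q i)"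
    and odd_part: "\<And>i. odd (coeff p (Suc (2 * i))) \<longleftrightarrow> odd (coeff r i)"
  shows "odd_coeffs p = odd_coeffs q + odd_coeffs r"
proof -
  let ?Q = "(*) 2 ` {i. odd (coeff q i)}" and ?R = "(\<lambda>i. Suc (2 * i)) ` {i. odd (coeff r i)}"
  have "odd (coeff p j) \<longleftrightarrow> j \<in> ?Q \<union> ?R" for j
  proof (cases "even j")
    case True
    then obtain i where "j = 2 * i" by blast
    then show ?thesis using even_part[of i] by (auto; presburger)
  next
    case False
    then obtain i where "j = Suc (2 * i)" by (auto elim: oddE)
    then show ?thesis using odd_part[of i] by (auto; presburger)
  qed
  then have "{j. odd (coeff p j)} = ?Q \<union> ?R"
    by blast
  moreover have "?Q \<inter> ?R = {}"
    by (auto; presburger)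
  ultimately show ?thesis
    by (simp add: odd_coeffs_def card_Un_disjoint finite_odd_coeffs card_image inj_on_def)
qed

text \<open>In (a + x p)^2 = a^2 + 2 a x p + x^2 p^2 the cross term is even. The last term shifts
  exponents by two, so parity of the index is kept and \<open>i\<close> drops by one in the
  induction.\<close>

lemma coeff_square_mod_2:
  fixes p :: "int poly"
  shows "odd (coeff (p\<^sup>2) (2 * i)) \<longleftrightarrow> odd (coeff p i)"
    and "even (coeff (p\<^sup>2) (Suc (2 * i)))"
proof (induction p arbitrary: i)
  case 0
  { case 1 show ?case by simp }
  { case 2 show ?case by simp }
next
  case (pCons a p)
  have double: "smult (2 * a) p = smult a p + smult a p"
    by (metis mult_2 smult_add_left)
  have sq: "(pCons a p)\<^sup>2 = [:a\<^sup>2:] + smult (2 * a) (pCons 0 p) + pCons 0 (pCons 0 (p\<^sup>2))"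
    by (simp add: power2_eq_square double)
  { case 1 show ?case
      using pCons.IH by (cases i) (simp_all add: sq) }
  { case 2 show ?case
      using pCons.IH by (cases i) (simp_all add: sq) }
qed

lemmas coeff_square_mod_2_simps =
  coeff_square_mod_2 coeff_square_mod_2[where i = 0, simplified]
  coeff_square_mod_2[where i = "Suc 0", simplified]
  coeff_square_mod_2[where i = "Suc i" for i, simplified]
  coeff_square_mod_2[where i = "Suc (Suc i)" for i, simplified]

text \<open>The terms 1 and x^2 meet even exponents and become 1 + x after halving them; the term x
  alone yields the odd part.\<close>

lemma odd_coeffs_trinomial_times_square:
  "odd_coeffs ([:1, 1, 1:] * p\<^sup>2) = odd_coeffs ([:1, 1:] * p) + odd_coeffs p"
proof (rule odd_coeffs_split)
  fix i
  show "odd (coeff ([:1, 1, 1:] * p\<^sup>2) (2 * i)) \<longleftrightarrow> odd (coeff ([:1, 1:] * p) i)"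
    by (cases i) (simp_all add: coeff_square_mod_2_simps)
  show "odd (coeff ([:1, 1, 1:] * p\<^sup>2) (Suc (2 * i))) \<longleftrightarrow> odd (coeff p i)"
    by (cases i) (simp_all add: coeff_square_mod_2_simps)
qed

text \<open>Modulo 2 the factor is 1 + x^3: the term 1 gives even part p, and x^3 = x * x^2 gives
  odd part x p.\<close>

lemma odd_coeffs_one_plus_X_trinomial_times_square:
  "odd_coeffs ([:1, 1:] * ([:1, 1, 1:] * p\<^sup>2)) = 2 * odd_coeffs p"
proof -
  have "[:1, 1:] * ([:1, 1, 1:] * p\<^sup>2) = [:1, 2, 2, 1:] * p\<^sup>2"
    by (simp flip: mult.assoc del: mult_pCons_left)
  also have "odd_coeffs \<dots> = odd_coeffs p + odd_coeffs (pCons 0 p)"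
  proof (rule odd_coeffs_split)
    fix i
    \<comment> \<open>The x^3 term reads the coefficient of \<open>p\<^sup>2\<close> at 2 i - 3,
      which exists only from i = 2 on.\<close>
    consider "i = 0" | "i = 1" | j where "i = Suc (Suc j)"
      by (metis One_nat_def not0_implies_Suc)
    note cases = this
    show "odd (coeff ([:1, 2, 2, 1:] * p\<^sup>2) (2 * i)) \<longleftrightarrow> odd (coeff p i)"
      by (cases rule: cases) (simp_all add: coeff_pCons coeff_square_mod_2_simps)
    show "odd (coeff ([:1, 2, 2, 1:] * p\<^sup>2) (Suc (2 * i))) \<longleftrightarrow> odd (coeff (pCons 0 p) i)"
      by (cases rule: cases) (simp_all add: coeff_pCons coeff_square_mod_2_simps)
  qed
  finally show ?thesis
    by (simp add: odd_coeffs_pCons_0)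
qed

lemma power_Mersenne_Suc:
  fixes x :: "'a :: comm_monoid_mult"
  shows "x ^ (2 ^ Suc k - 1) = x * (x ^ (2 ^ k - 1))\<^sup>2"
proof -
  have "2 ^ Suc k - 1 = Suc ((2 ^ k - 1) * 2 :: nat)"
    using one_le_power[of "2::nat" k] by (simp; linarith)
  then show ?thesis
    by (simp only: power_Suc power_mult)
qed

lemma b1_eq_odd_coeffs: "b1 k = odd_coeffs ([:1, 1, 1:] ^ (2 ^ k - 1))"
  by (simp add: b1_def a1_def odd_coeffs_def)

lemma b1_0: "b1 0 = 1"
proof -
  have "{i. odd (coeff (1 :: int poly) i)} = {0}"
    by auto
  then show ?thesis
    by (simp add: b1_eq_odd_coeffs odd_coeffs_def)
qed

lemma b1_1: "b1 1 = 3"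
proof -
  have "{i. odd (coeff ([:1, 1, 1:] :: int poly) i)} = {0, 1, 2}"
    by (auto simp: coeff_pCons split: nat.split_asm)
  then show ?thesis
    by (simp add: b1_eq_odd_coeffs odd_coeffs_def)
qed

text \<open>Fixing the instance \<open>Suc k\<close> first peels off only the outer factor; the
  summand for \<open>b1 (Suc k)\<close> then occurs on both sides, and the second peeling treats the
  one multiplied by 1 + x.\<close>

lemma b1_recurrence: "b1 (Suc (Suc k)) = b1 (Suc k) + 2 * b1 k"
  unfolding b1_eq_odd_coeffs power_Mersenne_Suc[where k = "Suc k"] odd_coeffs_trinomial_times_square
  unfolding power_Mersenne_Suc odd_coeffs_one_plus_X_trinomial_times_square by simp

theorem mainTheorem1:
  "f1 = (1 + 2 * fps_X) / ((1 + fps_X) * (1 - 2 * fps_X))"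
proof -
  let ?d = "(1 + fps_X) * (1 - 2 * fps_X) :: rat fps"
  have d: "?d = 1 - fps_X - 2 * (fps_X * fps_X)"
    by (simp add: algebra_simps)
  have "f1 * ?d = 1 + 2 * fps_X"
  proof (rule fps_ext)
    fix n
    \<comment> \<open>Only shifts by \<open>fps_X\<close> and a constant factor remain, so
      coefficient n reads b1(n) - b1(n-1) - 2 b1(n-2), with terms of negative index absent.\<close>
    have expand: "f1 * ?d = f1 - fps_X * f1 - fps_const 2 * (fps_X * (fps_X * f1))"
      unfolding d by (simp add: algebra_simps flip: numeral_fps_const)
    consider "n = 0" | "n = 1" | k where "n = Suc (Suc k)"
      by (metis One_nat_def not0_implies_Suc)
    then show "fps_nth (f1 * ?d) n = fps_nth (1 + 2 * fps_X) n"
      unfolding expand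
      by cases (simp_all add: f1_def b1_0 b1_1[simplified] b1_recurrence numeral_fps_const)
  qed
  moreover have "fps_nth ?d 0 \<noteq> 0"
    by simp
  then have "?d \<noteq> 0"
    by (metis fps_zero_nth)
  ultimately show ?thesis
    by (metis nonzero_mult_div_cancel_right)
qed

end
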